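(* Let $\varrho_0,\varrho_1\in\mathcal P_2(\mathbb R^d)$ with $\operatorname{supp}\varrho_0=B_{R_0}$ and $\operatorname{supp}\varrho_1=B_{R_1}$, $R_0,R_1>0$. Let $m\in(\frac d{d+2},1)$ satisfy $dm^2+(3-d)m-2>0$, let $\alpha=\frac1{2(1-m)}$ and $V(x)=c\langle x\rangle^{-2\alpha}$. Let $R>0$ be such that $\varrho_0(B_R)\ge\frac12$. Then there is a constant $C_{m,R}>0$ depending on $m$ and $R$ (and the dimension) such that, for $0<\varepsilon\ll1$, the functional $\mathcal U^m_\varepsilon$ is $\lambda_\varepsilon$-convex along the geodesic connecting $\varrho_0$ with $\varrho_1$, with $$\lambda_\varepsilon=-\varepsilon^{-3}C_{m,R}(1+R_0+R_1).$$
   Context: $\mathcal P_2(\mathbb R^d)$: Borel probability measures on $\mathbb R^d$ with finite second moment, with the 2-Wasserstein distance $d_W$. $B_R$: closed ball of radius $R$ centred at $0$. $\langle x\rangle:=\sqrt{1+|x|^2}$; $c=1/\int(1+|x|^2)^{-\alpha}dx$; $V_\varepsilon(x):=\varepsilon^{-d}V(x/\varepsilon)$. The condition $dm^2+(3-d)m-2>0$ is equivalent to $\frac1{2(1-m)}>\frac d2+\frac1m$. $\mathcal U^m_\varepsilon[\mu]:=-\frac1{1-m}\int_{\mathbb R^d}|V_\varepsilon*\mu|^m\,dx$. The geodesic connecting $\varrho_0$ to $\varrho_1$ is $\varrho_\beta:=((1-\beta)\pi^1+\beta\pi^2)_\#\gamma$, $\beta\in[0,1]$, with $\gamma$ an optimal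 transport plan between $\varrho_0$ and $\varrho_1$ for $d_W$ and $\pi^1,\pi^2$ the coordinate projections. A functional $\mathcal E$ is $\lambda$-convex along $\varrho_\beta$ if $\mathcal E[\varrho_\beta]\le(1-\beta)\mathcal E[\varrho_0]+\beta\mathcal E[\varrho_1]-\frac\lambda2\beta(1-\beta)d_W^2(\varrho_0,\varrho_1)$ for all $\beta\in[0,1]$. "$0<\varepsilon\ll1$" means for all sufficiently small $\varepsilon>0$. *)

theory Defs
  imports "HOL-Probability.Probability"
begin

section \<open>Wasserstein space\<close>

definition P2 :: "'a::euclidean_space measure set" where
  "P2 = {\<mu>. prob_space \<mu> \<and> sets \<mu> = sets borel \<and> integrable \<mu> (\<lambda>x. (norm x)\<^sup>2)}"

definition measure_support :: "'a::topological_space measure \<Rightarrow> 'a set" where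
  "measure_support \<mu> = {x. \<forall>U. open U \<longrightarrow> x \<in> U \<longrightarrow> emeasure \<mu> U > 0}"

definition couplings ::
  "'a::euclidean_space measure \<Rightarrow> 'a measure \<Rightarrow> ('a \<times> 'a) measure set" where
  "couplings \<mu> \<nu> = {\<gamma>. prob_space \<gamma> \<and> sets \<gamma> = sets borel \<and>
     distr \<gamma> borel fst = \<mu> \<and> distr \<gamma> borel snd = \<nu>}"

definition transport_cost :: "('a::euclidean_space \<times> 'a) measure \<Rightarrow> ennreal" where
  "transport_cost \<gamma> = (\<integral>\<^sup>+ z. ennreal ((dist (fst z) (snd z))\<^sup>2) \<partial>\<gamma>)"

definition optimal_plan ::
  "'a::euclidean_space measure \<Rightarrow> 'a measure \<Rightarrow> ('a \<times> 'a) measure \<Rightarrow> bool" where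
  "optimal_plan \<mu> \<nu> \<gamma> \<longleftrightarrow> \<gamma> \<in> couplings \<mu> \<nu> \<and>
     (\<forall>\<gamma>' \<in> couplings \<mu> \<nu>. transport_cost \<gamma> \<le> transport_cost \<gamma>')"

text \<open>On \<^const>\<open>P2\<close> the infimum below is finite, so \<^const>\<open>enn2real\<close> loses nothing.\<close>

definition wasserstein_dist :: "'a::euclidean_space measure \<Rightarrow> 'a measure \<Rightarrow> real" where
  "wasserstein_dist \<mu> \<nu> = sqrt (enn2real (INF \<gamma> \<in> couplings \<mu> \<nu>. transport_cost \<gamma>))"

definition interpolation ::
  "('a::euclidean_space \<times> 'a) measure \<Rightarrow> real \<Rightarrow> 'a measure" where
  "interpolation \<gamma> \<beta> = distr \<gamma> borel (\<lambda>z. (1 - \<beta>) *\<^sub>R fst z + \<beta> *\<^sub>R snd z)"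

text \<open>For \<open>\<gamma>\<close> a coupling, \<open>interpolation \<gamma> 0\<close> and \<open>interpolation \<gamma> 1\<close> are its two marginals.\<close>

definition lambda_convex_along ::
  "real \<Rightarrow> ('a::euclidean_space measure \<Rightarrow> real) \<Rightarrow> (real \<Rightarrow> 'a measure) \<Rightarrow> bool" where
  "lambda_convex_along lam E \<rho> \<longleftrightarrow> (\<forall>\<beta> \<in> {0..1}.
     E (\<rho> \<beta>) \<le> (1 - \<beta>) * E (\<rho> 0) + \<beta> * E (\<rho> 1)
              - lam / 2 * \<beta> * (1 - \<beta>) * (wasserstein_dist (\<rho> 0) (\<rho> 1))\<^sup>2)"

section \<open>The regularised energy\<close>

definition bracket :: "'a::euclidean_space \<Rightarrow> real" where
  "bracket x = sqrt (1 + (norm x)\<^sup>2)"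

definition kernel_const :: "'a::euclidean_space itself \<Rightarrow> real \<Rightarrow> real" where
  "kernel_const _ \<alpha> = 1 / (LINT x|lborel. (1 + (norm (x::'a))\<^sup>2) powr (-\<alpha>))"

definition bracket_kernel :: "real \<Rightarrow> 'a::euclidean_space \<Rightarrow> real" where
  "bracket_kernel \<alpha> x = kernel_const TYPE('a) \<alpha> * bracket x powr (- 2 * \<alpha>)"

definition rescale :: "real \<Rightarrow> ('a::euclidean_space \<Rightarrow> real) \<Rightarrow> 'a \<Rightarrow> real" where
  "rescale \<epsilon> V x = V (x /\<^sub>R \<epsilon>) / \<epsilon> ^ DIM('a)"

definition conv_measure ::
  "('a::euclidean_space \<Rightarrow> real) \<Rightarrow> 'a measure \<Rightarrow> 'a \<Rightarrow> real" where
  "conv_measure V \<mu> x = (LINT y|\<mu>. V (x - y))"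

text \<open>
  For \<open>V\<close> the kernel with \<open>\<alpha> = 1 / (2 * (1 - m))\<close>, where \<open>d / (d + 2) < m < 1\<close> and
  \<open>\<alpha> > d / 2 + 1 / m\<close>, the integrand is integrable for every \<open>\<mu> \<in> P2\<close>, so the default
  value 0 of the Bochner integral does not occur.
\<close>

definition reg_energy ::
  "('a::euclidean_space \<Rightarrow> real) \<Rightarrow> real \<Rightarrow> real \<Rightarrow> 'a measure \<Rightarrow> real" where
  "reg_energy V m \<epsilon> \<mu> =
     - (1 / (1 - m)) * (LINT x|lborel. \<bar>conv_measure (rescale \<epsilon> V) \<mu> x\<bar> powr m)"

end

theory Submission
  imports Defs
begin

text \<open>
  Differentiating twice under the integral is avoided. Write \<open>v\<^sub>b = V\<^sub>\<epsilon> * \<rho>\<^sub>b\<close>. The tangent line to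
  the concave function \<open>t powr m\<close> at \<open>v\<^sub>b\<close> bounds \<open>(1 - b) v\<^sub>0\<^sup>m + b v\<^sub>1\<^sup>m - v\<^sub>b\<^sup>m\<close> by
  \<open>m v\<^sub>b\<^bsup>m - 1\<^esup>\<close> times the convexity defect of \<open>b \<mapsto> v\<^sub>b\<close>. That defect is an average over the
  plan of defects of the smooth kernel along segments, controlled by an upper bound
  \<open>C \<epsilon>\<^bsup>-2\<^esup> \<bar>h\<bar>\<^sup>2 \<langle>\<cdot>/\<epsilon>\<rangle>\<^bsup>-2\<alpha> - 2\<^esup>\<close> on the second derivative of the scaled kernel along the
  displacement \<open>h\<close>. At least half of the mass of \<open>\<rho>\<^sub>b\<close> lies within \<open>R + R\<^sub>1\<close> of the origin, and
  \<open>2\<alpha>(1 - m) = 1\<close>, so \<open>v\<^sub>b\<^bsup>m - 1\<^esup>\<close> grows only linearly, like \<open>\<langle>x/\<epsilon>\<rangle> + (R + R\<^sub>1)/\<epsilon>\<close>. This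
  costs one power of \<open>\<langle>\<cdot>/\<epsilon>\<rangle>\<close> and one further factor \<open>(1 + R\<^sub>0 + R\<^sub>1)/\<epsilon>\<close>, and what remains,
  \<open>\<langle>\<cdot>/\<epsilon>\<rangle>\<^bsup>-2\<alpha> - 1\<^esup>\<close>, is integrable, so Tonelli yields the quadratic transport cost.
\<close>

section \<open>The bracket: elementary bounds and integrability of its powers\<close>

lemma bracket_ge_1: "1 \<le> bracket x"
  by (simp add: bracket_def)

lemma bracket_pos [simp]: "0 < bracket x"
  using bracket_ge_1[of x] by simp

lemma norm_le_bracket: "norm x \<le> bracket x"
  unfolding bracket_def by (rule real_le_rsqrt) simp

lemma borel_measurable_bracket [measurable (raw)]:
  "f \<in> borel_measurable M \<Longrightarrow> (\<lambda>x. bracket (f x)) \<in> borel_measurable M"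
  unfolding bracket_def by measurable

text \<open>\<open>bracket x\<close> is the norm of the pair (1, x), so this is the triangle
  inequality.\<close>

lemma bracket_le_add_norm: "bracket x \<le> bracket y + norm (x - y)"
proof -
  have eq: "bracket z = norm (1::real, z)" for z :: 'a
    by (simp add: bracket_def norm_Pair)
  have "norm (1::real, x) \<le> norm (1::real, y) + norm ((1::real, x) - (1, y))"
    by (rule norm_triangle_sub)
  then show ?thesis
    by (simp add: eq norm_Pair)
qed

lemma bracket_powr_le_1: "0 \<le> p \<Longrightarrow> bracket x powr (-p) \<le> 1"
  using powr_mono[of "-p" 0 "bracket x"] bracket_ge_1[of x] by simp

text \<open>The integrand is dominated by a sum over balls of radius 2^n with weights comparable to
  2^(-n p). Integrating gives a geometric series of ratio 2^(d - p) < 1, where d is the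
  dimension.\<close>

lemma nn_integral_bracket_powr_finite:
  assumes "real DIM('a::euclidean_space) < p"
  shows "(\<integral>\<^sup>+x. ennreal (bracket (x::'a) powr (-p)) \<partial>lborel) < \<infinity>"
proof -
  define f where "f n x = ennreal (2 powr p * (2 ^ n) powr (-p)) * indicator (cball 0 (2 ^ n)) x"
    for n :: nat and x :: 'a
  have p: "0 < p"
    using assms by (rule le_less_trans[rotated]) simp
  have [measurable]: "f n \<in> borel_measurable borel" for n
    unfolding f_def by (intro borel_measurable_times_ennreal borel_measurable_indicator) auto
  have "ennreal (bracket x powr (-p)) \<le> (\<Sum>n. f n x)" for x :: 'a
  proof -
    define n where "n = (LEAST n. bracket x \<le> 2 ^ n)"
    have ex: "\<exists>n. bracket x \<le> 2 ^ n"
      using real_arch_pow[of 2 "bracket x"] by (auto intro: less_imp_le)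
    have le: "bracket x \<le> 2 ^ n"
      unfolding n_def by (rule LeastI_ex) (rule ex)
    \<comment> \<open>Minimality keeps \<open>2 ^ n\<close> from overshooting by more than a factor
      2, which the weight \<open>2 powr p\<close> in \<open>f\<close> absorbs. A single term of the
      series then dominates.\<close>
    have "2 ^ n \<le> 2 * bracket x"
    proof (cases n)
      case 0
      then show ?thesis using bracket_ge_1[of x] by simp
    next
      case (Suc k)
      have "\<not> bracket x \<le> 2 ^ k"
        using not_less_Least[of k "\<lambda>n. bracket x \<le> 2 ^ n"] Suc by (simp add: n_def)
      then show ?thesis by (simp add: Suc)
    qed
    then have "(2 * bracket x) powr (-p) \<le> (2 ^ n) powr (-p)"
      using p by (intro powr_mono2') auto
    then have "2 powr p * (2 powr (-p) * bracket x powr (-p)) \<le> 2 powr p * (2 ^ n) powr (-p)"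
      by (intro mult_left_mono) (simp_all add: powr_mult)
    then have "bracket x powr (-p) \<le> 2 powr p * (2 ^ n) powr (-p)"
      by (simp add: powr_minus field_simps)
    then have "ennreal (bracket x powr (-p)) \<le> f n x"
      using le norm_le_bracket[of x] by (auto simp: f_def intro!: ennreal_leI split: split_indicator)
    also have "\<dots> = sum (\<lambda>n. f n x) {n}" by simp
    also have "\<dots> \<le> (\<Sum>n. f n x)" by (rule sum_le_suminf) auto
    finally show ?thesis .
  qed
  then have "(\<integral>\<^sup>+x. ennreal (bracket (x::'a) powr (-p)) \<partial>lborel) \<le> (\<integral>\<^sup>+x. (\<Sum>n. f n x) \<partial>lborel)"
    by (intro nn_integral_mono) auto
  also have "\<dots> = (\<Sum>n. \<integral>\<^sup>+x. f n x \<partial>lborel)"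
    by (rule nn_integral_suminf) auto
  also have "\<dots> = (\<Sum>n. ennreal (2 powr p * unit_ball_vol DIM('a) * (2 powr (DIM('a) - p)) ^ n))"
  proof (rule suminf_cong)
    fix n
    have "(2 ^ n) powr (-p) * (2 ^ n) ^ DIM('a) = (2 powr (DIM('a) - p)) ^ n"
      by (simp add: powr_realpow[symmetric] powr_powr powr_add[symmetric] algebra_simps)
    moreover have "2 powr p * (2 ^ n) powr (-p) * (unit_ball_vol DIM('a) * (2 ^ n) ^ DIM('a))
       = 2 powr p * unit_ball_vol DIM('a) * ((2 ^ n) powr (-p) * (2 ^ n) ^ DIM('a))"
      by (simp only: mult_ac)
    ultimately have "2 powr p * (2 ^ n) powr (-p) * (unit_ball_vol DIM('a) * (2 ^ n) ^ DIM('a))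
       = 2 powr p * unit_ball_vol DIM('a) * (2 powr (DIM('a) - p)) ^ n"
      by simp
    then have "ennreal (2 powr p * (2 ^ n) powr (-p)) * emeasure lborel (cball (0::'a) (2 ^ n))
        = ennreal (2 powr p * unit_ball_vol DIM('a) * (2 powr (DIM('a) - p)) ^ n)"
      by (simp only: emeasure_cball ennreal_mult'[symmetric] mult_nonneg_nonneg powr_ge_zero
          zero_le_power zero_le_numeral)
    then show "(\<integral>\<^sup>+x. f n x \<partial>lborel)
        = ennreal (2 powr p * unit_ball_vol DIM('a) * (2 powr (DIM('a) - p)) ^ n)"
      unfolding f_def by (subst nn_integral_cmult_indicator) auto
  qed
  also have "\<dots> < \<infinity>"
  proof -
    have "(2::real) powr (DIM('a) - p) < 1"
      using assms by (simp add: powr_less_one)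
    then have "summable (\<lambda>n. 2 powr p * unit_ball_vol DIM('a) * (2 powr (DIM('a) - p)) ^ n)"
      by (intro summable_mult summable_geometric) simp
    then show ?thesis
      by (simp add: ennreal_suminf_neq_top less_top)
  qed
  finally show ?thesis .
qed

text \<open>The Jacobian of x = z + \<epsilon> y does not see the shift \<open>z\<close>; this later
  makes the integral over x independent of time and of the point of the plan.\<close>

lemma nn_integral_rescale:
  fixes f :: "'a::euclidean_space \<Rightarrow> ennreal"
  assumes [measurable]: "f \<in> borel_measurable borel" and "0 < \<epsilon>"
  shows "(\<integral>\<^sup>+x. f ((x - z) /\<^sub>R \<epsilon>) \<partial>lborel) = ennreal (\<epsilon> ^ DIM('a)) * (\<integral>\<^sup>+y. f y \<partial>lborel)"
  using assms(2)
  by (subst lborel_affine[of \<epsilon> z])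
     (simp_all add: nn_integral_density nn_integral_distr nn_integral_cmult)

section \<open>Integration, supports and convexity inequalities\<close>

text \<open>\<open>ennreal\<close> cuts off the negative part of \<open>f\<close>, and a
  non-integrable \<open>f\<close> has Bochner integral 0. Signed defects can thus be bounded without
  prior integrability.\<close>

lemma ennreal_integral_le_nn_integral:
  "ennreal (integral\<^sup>L M f) \<le> (\<integral>\<^sup>+x. ennreal (f x) \<partial>M)"
proof (cases "integrable M f")
  case True
  have "integral\<^sup>L M f \<le> (LINT x|M. max 0 (f x))"
    using True by (intro integral_mono) auto
  then have "ennreal (integral\<^sup>L M f) \<le> ennreal (LINT x|M. max 0 (f x))"
    by (rule ennreal_leI)
  also have "\<dots> = (\<integral>\<^sup>+x. ennreal (max 0 (f x)) \<partial>M)"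
    using True by (intro nn_integral_eq_integral[symmetric]) auto
  also have "\<dots> = (\<integral>\<^sup>+x. ennreal (f x) \<partial>M)"
    by (intro nn_integral_cong) (simp add: max_def ennreal_neg)
  finally show ?thesis .
qed (simp add: not_integrable_integral_eq)

lemma ennreal_add_le: "0 \<le> a \<Longrightarrow> ennreal (a + b) \<le> ennreal a + ennreal b"
  by (cases "0 \<le> b") (simp_all add: ennreal_neg ennreal_leI)

text \<open>The complement of the support is covered by the null members of a countable
  basis.\<close>

lemma AE_in_measure_support:
  fixes \<mu> :: "'a::second_countable_topology measure"
  assumes "sets \<mu> = sets borel"
  shows "AE x in \<mu>. x \<in> measure_support \<mu>"
proof -
  obtain B :: "'a set set" where B: "countable B" "topological_basis B"
    using ex_countable_basis by auto
  define N where "N = \<Union>{U\<in>B. emeasure \<mu> U = 0}"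
  have "N \<in> null_sets \<mu>"
    unfolding N_def using B topological_basis_open[OF B(2)]
    by (intro null_sets_UN'[where N="\<lambda>U. U" and I="{U\<in>B. emeasure \<mu> U = 0}", simplified])
       (auto simp: assms null_sets_def intro: countable_subset)
  moreover have "{x \<in> space \<mu>. x \<notin> measure_support \<mu>} \<subseteq> N"
  proof
    fix x assume "x \<in> {x \<in> space \<mu>. x \<notin> measure_support \<mu>}"
    then obtain U where U: "open U" "x \<in> U" "emeasure \<mu> U = 0"
      by (auto simp: measure_support_def)
    obtain W where W: "W \<in> B" "x \<in> W" "W \<subseteq> U"
      using topological_basisE[OF B(2) U(1,2)] by blast
    have "emeasure \<mu> W \<le> emeasure \<mu> U"
      using W U(1) by (intro emeasure_mono) (auto simp: assms)
    then show "x \<in> N"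
      using W U(3) by (auto simp: N_def)
  qed
  ultimately show ?thesis
    by (auto intro: AE_I')
qed

text \<open>The weighted arithmetic-geometric mean inequality, multiplied by
  \<open>s powr (m - 1)\<close>. The value t = 0 is split off because Young's inequality is applied
  to positive numbers.\<close>

lemma powr_tangent_le:
  fixes s t m :: real
  assumes "0 < s" "0 \<le> t" "0 < m" "m < 1"
  shows "t powr m \<le> s powr m + m * s powr (m - 1) * (t - s)"
proof (cases "t = 0")
  case True
  then show ?thesis
    using assms by (simp add: powr_diff)
next
  case False
  then have "t powr m * s powr (1 - m) \<le> m * t + (1 - m) * s"
    using assms by (intro Youngs_inequality_0) auto
  then have "s powr (m - 1) * (t powr m * s powr (1 - m)) \<le> s powr (m - 1) * (m * t + (1 - m) * s)"
    by (intro mult_left_mono) auto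
  moreover have "s powr (m - 1) * s powr (1 - m) = 1" "s powr (m - 1) * s = s powr m"
    using assms by (simp_all add: powr_add[symmetric] powr_mult_base mult.commute)
  ultimately show ?thesis
    by (simp add: algebra_simps)
qed

text \<open>Optimality means that the infimum is attained at \<gamma>. Finiteness matters because
  \<open>enn2real\<close> sends \<infinity> to 0.\<close>

lemma optimal_plan_cost:
  assumes "optimal_plan \<mu> \<nu> \<gamma>" "transport_cost \<gamma> < \<infinity>"
  shows "transport_cost \<gamma> = ennreal ((wasserstein_dist \<mu> \<nu>)\<^sup>2)"
proof -
  have "(INF \<gamma>'\<in>couplings \<mu> \<nu>. transport_cost \<gamma>') = transport_cost \<gamma>"
    using assms(1) unfolding optimal_plan_def
    by (intro antisym INF_greatest) (auto intro: INF_lower)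
  then show ?thesis
    using assms(2) by (simp add: wasserstein_dist_def)
qed

lemma (in prob_space) integral_ge_of_event:
  fixes f :: "'a \<Rightarrow> real"
  assumes "integrable M f" "E \<in> events" "AE x in M. 0 \<le> f x" "AE x in M. x \<in> E \<longrightarrow> b \<le> f x"
  shows "b * prob E \<le> expectation f"
proof -
  have "(LINT x|M. b * indicator E x) \<le> expectation f"
    using assms by (intro integral_mono_AE) (auto split: split_indicator simp: less_top[symmetric])
  then show ?thesis using assms(2) by simp
qed

text \<open>
  The left-hand side is the integral of \<open>g''\<close> against the Green function of the unit interval
  with pole \<open>b\<close>, and that function is at most \<open>b * (1 - b)\<close>.
\<close>

lemma convexity_defect_le:
  fixes g g' g'' K :: "real \<Rightarrow> real"
  assumes g: "\<And>s. (g has_real_derivative g' s) (at s)" "\<And>s. (g' has_real_derivative g'' s) (at s)"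
    and cont: "\<And>s. isCont g'' s"
    and K: "\<And>s. g'' s \<le> K s" "\<And>s. 0 \<le> K s"
    and b: "0 \<le> b" "b \<le> 1"
  shows "ennreal ((1 - b) * g 0 + b * g 1 - g b)
    \<le> (\<integral>\<^sup>+s. ennreal (b * (1 - b) * K s) * indicator {0..1} s \<partial>lborel)"
proof -
  \<comment> \<open>These are the two branches of the Green function times \<open>g''\<close>. Up to
    their constant factors, the antiderivatives are s g' - g and (1 - s) g' + g; in the sum the
    terms with \<open>g' b\<close> cancel.\<close>
  let ?L = "\<lambda>s. (1 - b) * (s * g'' s) * indicator {0..b} s"
  let ?R = "\<lambda>s. b * ((1 - s) * g'' s) * indicator {b..1} s"
  have L: "has_bochner_integral lborel ?L ((1 - b) * (b * g' b - g b) - (1 - b) * (0 * g' 0 - g 0))"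
    using b cont by (intro has_bochner_integral_FTC_Icc_real)
      (auto intro!: derivative_eq_intros g continuous_intros simp: algebra_simps)
  have R: "has_bochner_integral lborel ?R
      (b * ((1 - 1) * g' 1 + g 1) - b * ((1 - b) * g' b + g b))"
    using b cont by (intro has_bochner_integral_FTC_Icc_real)
      (auto intro!: derivative_eq_intros g continuous_intros simp: algebra_simps)
  have eq: "(1 - b) * g 0 + b * g 1 - g b = (LINT s|lborel. ?L s + ?R s)"
    using has_bochner_integral_integral_eq[OF has_bochner_integral_add[OF L R]]
    by (simp add: algebra_simps)
  have "ennreal ((1 - b) * g 0 + b * g 1 - g b) \<le> (\<integral>\<^sup>+s. ennreal (?L s + ?R s) \<partial>lborel)"
    unfolding eq by (rule ennreal_integral_le_nn_integral)
  also have "\<dots> \<le> (\<integral>\<^sup>+s. ennreal (b * (1 - b) * K s) * indicator {0..1} s \<partial>lborel)"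
  proof (rule nn_integral_mono_AE)
    \<comment> \<open>The pole s = b lies in both closed intervals and would be counted twice; it is
      a null set.\<close>
    have "ennreal (?L s + ?R s) \<le> ennreal (b * (1 - b) * K s) * indicator {0..1} s" if "s \<noteq> b" for s
    proof -
      have "(s < 0 \<or> 1 < s) \<or> (0 \<le> s \<and> s < b) \<or> (b < s \<and> s \<le> 1)"
        using that by linarith
      then consider "s < 0 \<or> 1 < s" | "0 \<le> s" "s < b" | "b < s" "s \<le> 1"
        by blast
      then show ?thesis
      proof cases
        case 1
        then have "indicat_real {0..b} s = 0" "indicat_real {b..1} s = 0"
          using b by (auto simp: indicator_eq_0_iff)
        then show ?thesis by (simp only: mult_zero_right add_0 ennreal_0 zero_le)
      next
        case 2
        have "(1 - b) * (s * g'' s) \<le> (1 - b) * (s * K s)"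
          using b 2 K by (intro mult_left_mono) auto
        also have "\<dots> \<le> (1 - b) * (b * K s)"
          using b 2 K by (intro mult_left_mono mult_right_mono) auto
        finally have "(1 - b) * (s * g'' s) \<le> b * (1 - b) * K s" by (simp add: mult_ac)
        moreover have "indicat_real {0..b} s = 1" "indicat_real {b..1} s = 0"
          "indicator {0..1} s = (1::ennreal)"
          using b 2 by (auto simp: indicator_eq_0_iff indicator_eq_1_iff)
        ultimately show ?thesis
          by (simp only: mult_zero_right mult_1_right add_0 add_0_right ennreal_leI)
      next
        case 3
        have "b * ((1 - s) * g'' s) \<le> b * ((1 - s) * K s)"
          using b 3 K by (intro mult_left_mono) auto
        also have "\<dots> \<le> b * ((1 - b) * K s)"
          using b 3 K by (intro mult_left_mono mult_right_mono) auto
        finally have "b * ((1 - s) * g'' s) \<le> b * (1 - b) * K s" by (simp add: mult_ac)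
        moreover have "indicat_real {0..b} s = 0" "indicat_real {b..1} s = 1"
          "indicator {0..1} s = (1::ennreal)"
          using b 3 by (auto simp: indicator_eq_0_iff indicator_eq_1_iff)
        ultimately show ?thesis
          by (simp only: mult_zero_right mult_1_right add_0 add_0_right ennreal_leI)
      qed
    qed
    then show "AE s in lborel. ennreal (?L s + ?R s) \<le> ennreal (b * (1 - b) * K s) * indicator {0..1} s"
      by - (rule AE_mp[OF AE_lborel_singleton[of b]], auto)
  qed
  finally show ?thesis .
qed


text \<open>The kernel is a power of the squared bracket \<open>q\<close>, which is quadratic and
  positive along the whole line. Hence \<open>convexity_defect_le\<close> applies, and no square
  root has to be differentiated.\<close>

lemma bracket_powr_defect_le:
  fixes u h :: "'a::euclidean_space"
  assumes "0 < a" "0 \<le> b" "b \<le> 1"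
  shows "ennreal ((1 - b) * bracket u powr (-2 * a) + b * bracket (u - h) powr (-2 * a)
      - bracket (u - b *\<^sub>R h) powr (-2 * a))
    \<le> (\<integral>\<^sup>+s. ennreal (b * (1 - b) * (4 * a * (a + 1) * (norm h)\<^sup>2 *
          bracket (u - s *\<^sub>R h) powr (-2 * a - 2))) * indicator {0..1} s \<partial>lborel)"
proof -
  define q where "q s = (bracket (u - s *\<^sub>R h))\<^sup>2" for s
  define q' where "q' s = - 2 * (h \<bullet> (u - s *\<^sub>R h))" for s
  have q_pos: "0 < q s" for s
    unfolding q_def by (intro zero_less_power bracket_pos)
  have powr_q: "q s powr r = bracket (u - s *\<^sub>R h) powr (2 * r)" for s r
    unfolding q_def by (metis bracket_pos powr_powr powr_realpow of_nat_numeral)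
  have q_eq: "q s = 1 + (u \<bullet> u) - 2 * s * (h \<bullet> u) + s\<^sup>2 * (h \<bullet> h)" for s
  proof -
    have "q s = 1 + (u - s *\<^sub>R h) \<bullet> (u - s *\<^sub>R h)"
      by (simp add: q_def bracket_def power2_norm_eq_inner)
    then show ?thesis
      by (simp add: inner_diff_left inner_diff_right inner_commute algebra_simps power2_eq_square)
  qed
  have dq: "(q has_real_derivative q' s) (at s)" for s
    unfolding q_eq[abs_def] q'_def
    by (auto intro!: derivative_eq_intros simp: inner_diff_right algebra_simps)
  have dq': "(q' has_real_derivative 2 * (norm h)\<^sup>2) (at s)" for s
    unfolding q'_def inner_diff_right inner_scaleR_right power2_norm_eq_inner
    by (auto intro!: derivative_eq_intros)
  let ?g = "\<lambda>s. q s powr (-a)"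
  let ?g' = "\<lambda>s. - a * (q s powr (-a - 1) * q' s)"
  let ?g'' = "\<lambda>s. - a * ((-a - 1) * q s powr (-a - 2) * (q' s)\<^sup>2 + q s powr (-a - 1) * (2 * (norm h)\<^sup>2))"
  let ?K = "\<lambda>s. 4 * a * (a + 1) * (norm h)\<^sup>2 * q s powr (-a - 1)"
  have "ennreal ((1 - b) * ?g 0 + b * ?g 1 - ?g b)
      \<le> (\<integral>\<^sup>+s. ennreal (b * (1 - b) * ?K s) * indicator {0..1} s \<partial>lborel)"
  proof (rule convexity_defect_le)
    show "(?g has_real_derivative ?g' s) (at s)" for s
      by (rule derivative_eq_intros dq refl q_pos)+ (simp add: mult_ac)
    have commute: "- 2 - a = - a - 2" by simp
    have dqa: "((\<lambda>s. q s powr (-a - 1)) has_real_derivative (-a - 1) * (q s powr (-a - 2) * q' s)) (at s)" for s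
      by (rule derivative_eq_intros dq refl q_pos)+ (simp add: mult_ac commute)
    show "(?g' has_real_derivative ?g'' s) (at s)" for s
      by (rule DERIV_cong[OF DERIV_cmult[OF DERIV_mult[OF dqa dq']]]) (simp add: power2_eq_square)
    have "isCont q s" "isCont q' s" for s
      using dq dq' by (auto intro: DERIV_isCont)
    then show "isCont ?g'' s" for s
      using q_pos[of s] by (intro continuous_intros) auto
    \<comment> \<open>Cauchy-Schwarz bounds the square of q' by 4 |h|^2 q, which raises the power of
      \<open>q\<close> by one; the other summand of \<open>?g''\<close> is nonpositive and is
      dropped.\<close>
    show "?g'' s \<le> ?K s" for s
    proof -
      have "(h \<bullet> (u - s *\<^sub>R h))\<^sup>2 \<le> (norm h)\<^sup>2 * (norm (u - s *\<^sub>R h))\<^sup>2"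
        using Cauchy_Schwarz_ineq[of h "u - s *\<^sub>R h"] by (simp add: power2_norm_eq_inner)
      also have "\<dots> \<le> (norm h)\<^sup>2 * q s"
        unfolding q_def by (intro mult_left_mono power_mono norm_le_bracket) auto
      finally have "(q' s)\<^sup>2 \<le> 4 * (norm h)\<^sup>2 * q s"
        by (simp add: q'_def power_mult_distrib)
      then have "q s powr (-a - 2) * (q' s)\<^sup>2 \<le> q s powr (-a - 2) * (4 * (norm h)\<^sup>2 * q s)"
        by (intro mult_left_mono) auto
      also have "\<dots> = 4 * (norm h)\<^sup>2 * (q s powr (-a - 2) * q s powr 1)"
        using q_pos[of s] by simp
      also have "q s powr (-a - 2) * q s powr 1 = q s powr (-a - 1)"
        by (subst powr_add[symmetric]) (rule arg_cong, simp)
      finally have "a * (a + 1) * (q s powr (-a - 2) * (q' s)\<^sup>2)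
          \<le> a * (a + 1) * (4 * (norm h)\<^sup>2 * q s powr (-a - 1))"
        using assms by (intro mult_left_mono) auto
      moreover have "0 \<le> a * (q s powr (-a - 1) * (2 * (norm h)\<^sup>2))"
        using assms by auto
      ultimately show ?thesis
        by (simp add: algebra_simps)
    qed
    show "0 \<le> ?K s" for s
      using assms by auto
  qed (use assms in auto)
  then show ?thesis
    by (simp add: powr_q algebra_simps)
qed

section \<open>The convolution along the interpolation: upper and lower bounds\<close>

text \<open>The map pushed forward in \<open>interpolation\<close>, with time as an argument so that
  joint measurability in time and plan can be stated.\<close>

definition segm :: "real \<Rightarrow> 'a::real_vector \<times> 'a \<Rightarrow> 'a" where
  "segm s z = (1 - s) *\<^sub>R fst z + s *\<^sub>R snd z"

lemma norm_segm_le: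
  fixes z :: "'a::real_normed_vector \<times> 'a"
  assumes "norm (fst z) \<le> r" "norm (snd z) \<le> t" "0 \<le> s" "s \<le> 1"
  shows "norm (segm s z) \<le> r + t"
proof -
  have "norm (segm s z) \<le> (1 - s) * norm (fst z) + s * norm (snd z)"
    unfolding segm_def using assms by (intro norm_triangle_le) auto
  also have "\<dots> \<le> 1 * norm (fst z) + 1 * norm (snd z)"
    using assms by (intro add_mono mult_right_mono) auto
  finally show ?thesis using assms by simp
qed

lemma borel_measurable_segm [measurable (raw)]:
  fixes f :: "'b \<Rightarrow> 'a::euclidean_space \<times> 'a"
  assumes "g \<in> borel_measurable M" "f \<in> M \<rightarrow>\<^sub>M borel \<Otimes>\<^sub>M borel"
  shows "(\<lambda>x. segm (g x) (f x)) \<in> borel_measurable M"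
  using assms unfolding segm_def by measurable

text \<open>The sigma-algebra is written as a product, which suits measurability and Tonelli;
  \<open>borel_prod\<close> identifies it with the one in \<open>couplings\<close>.\<close>

locale bounded_plan = prob_space \<gamma> for \<gamma> :: "('a::euclidean_space \<times> 'a) measure" +
  fixes \<alpha> \<epsilon> R\<^sub>0 R\<^sub>1 :: real
  assumes sets_plan [measurable_cong]: "sets \<gamma> = sets (borel \<Otimes>\<^sub>M borel)"
    and AE_fst: "AE z in \<gamma>. norm (fst z) \<le> R\<^sub>0"
    and AE_snd: "AE z in \<gamma>. norm (snd z) \<le> R\<^sub>1"
    and \<alpha>_pos: "0 < \<alpha>" and \<epsilon>_pos: "0 < \<epsilon>"
begin

text \<open>
  The unnormalised convolution: the constant in front of the kernel is restored in
  \<open>reg_energy_interpolation\<close>.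
\<close>

definition pot :: "real \<Rightarrow> 'a \<Rightarrow> real" where
  "pot s x = (LINT z|\<gamma>. bracket ((x - segm s z) /\<^sub>R \<epsilon>) powr (-2 * \<alpha>))"

lemma borel_measurable_pot [measurable]: "pot s \<in> borel_measurable borel"
  unfolding pot_def by measurable

lemma AE_norm_segm: "AE z in \<gamma>. \<forall>s\<in>{0..1}. norm (segm s z) \<le> R\<^sub>0 + R\<^sub>1"
  using AE_fst AE_snd by eventually_elim (auto intro: norm_segm_le)

text \<open>An a.e. property that does not mention the point is true outright, since \<gamma> has
  mass one.\<close>

lemma radii_nonneg: "0 \<le> R\<^sub>0" "0 \<le> R\<^sub>1"
proof -
  have "AE z in \<gamma>. 0 \<le> R\<^sub>0 \<and> 0 \<le> R\<^sub>1"
    using AE_fst AE_snd by eventually_elim (use norm_ge_zero order_trans in blast)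
  then show "0 \<le> R\<^sub>0" "0 \<le> R\<^sub>1"
    by simp_all
qed

lemma integrable_kernel: "integrable \<gamma> (\<lambda>z. bracket ((x - segm s z) /\<^sub>R \<epsilon>) powr (-2 * \<alpha>))"
  using bracket_powr_le_1[of "2 * \<alpha>"] \<alpha>_pos by (intro integrable_const_bound[of _ 1]) auto

lemma pot_nonneg: "0 \<le> pot s x"
  unfolding pot_def by (rule integral_nonneg_AE) simp

lemma bracket_rescale_le:
  "bracket (x /\<^sub>R \<epsilon>) \<le> bracket ((x - y) /\<^sub>R \<epsilon>) + norm y / \<epsilon>"
  using bracket_le_add_norm[of "x /\<^sub>R \<epsilon>" "(x - y) /\<^sub>R \<epsilon>"] \<epsilon>_pos
  by (simp add: scaleR_diff_right[symmetric] divide_inverse mult.commute)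

text \<open>A Peetre-type inequality: moving the centre by at most
  \<open>R\<^sub>0 + R\<^sub>1\<close> changes the bracket by a bounded factor. The factor blows up
  as \<epsilon> tends to 0, but it serves integrability only and does not enter the convexity
  constant.\<close>

lemma pot_le:
  assumes "s \<in> {0..1}"
  shows "pot s x \<le> (1 + (R\<^sub>0 + R\<^sub>1) / \<epsilon>) powr (2 * \<alpha>) * bracket (x /\<^sub>R \<epsilon>) powr (-2 * \<alpha>)"
proof -
  let ?r = "(R\<^sub>0 + R\<^sub>1) / \<epsilon>"
  have r: "0 \<le> ?r"
    using radii_nonneg \<epsilon>_pos by simp
  have "AE z in \<gamma>. bracket ((x - segm s z) /\<^sub>R \<epsilon>) powr (-2 * \<alpha>)
      \<le> (1 + ?r) powr (2 * \<alpha>) * bracket (x /\<^sub>R \<epsilon>) powr (-2 * \<alpha>)"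
    using AE_norm_segm
  proof eventually_elim
    case (elim z)
    let ?y = "(x - segm s z) /\<^sub>R \<epsilon>"
    have "bracket (x /\<^sub>R \<epsilon>) \<le> bracket ?y + norm (segm s z) / \<epsilon>"
      by (rule bracket_rescale_le)
    also have "\<dots> \<le> bracket ?y * 1 + bracket ?y * ?r"
    proof -
      have "norm (segm s z) / \<epsilon> \<le> 1 * ?r"
        using elim assms \<epsilon>_pos by (simp add: divide_right_mono)
      also have "\<dots> \<le> bracket ?y * ?r"
        using r bracket_ge_1 by (intro mult_right_mono) auto
      finally show ?thesis by simp
    qed
    finally have "bracket (x /\<^sub>R \<epsilon>) \<le> (1 + ?r) * bracket ?y"
      by (simp add: algebra_simps)
    then have "((1 + ?r) * bracket ?y) powr (-2 * \<alpha>) \<le> bracket (x /\<^sub>R \<epsilon>) powr (-2 * \<alpha>)"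
      using \<alpha>_pos by (intro powr_mono2') auto
    then have "(1 + ?r) powr (2 * \<alpha>) * ((1 + ?r) powr (-2 * \<alpha>) * bracket ?y powr (-2 * \<alpha>))
        \<le> (1 + ?r) powr (2 * \<alpha>) * bracket (x /\<^sub>R \<epsilon>) powr (-2 * \<alpha>)"
      using r by (intro mult_left_mono) (auto simp: powr_mult)
    moreover have "(1 + ?r) powr (2 * \<alpha>) * (1 + ?r) powr (-2 * \<alpha>) = 1"
      using r by (simp add: powr_add[symmetric])
    ultimately show ?case
      by (simp only: mult.assoc[symmetric] mult_1_left)
  qed
  then have "pot s x \<le> (LINT z|\<gamma>. (1 + ?r) powr (2 * \<alpha>) * bracket (x /\<^sub>R \<epsilon>) powr (-2 * \<alpha>))"
    unfolding pot_def by (intro integral_mono_AE integrable_kernel) auto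
  then show ?thesis by (simp add: prob_space)
qed

lemma integrable_pot_powr:
  assumes "s \<in> {0..1}" "0 < m" "real DIM('a) < 2 * \<alpha> * m"
  shows "integrable lborel (\<lambda>x. pot s x powr m)"
proof (rule integrableI_bounded)
  let ?C = "((1 + (R\<^sub>0 + R\<^sub>1) / \<epsilon>) powr (2 * \<alpha>)) powr m"
  have "pot s x powr m \<le> ?C * bracket (x /\<^sub>R \<epsilon>) powr (-(2 * \<alpha> * m))" for x
    using powr_mono2[OF less_imp_le[OF assms(2)] pot_nonneg pot_le[OF assms(1), of x]]
    by (simp add: powr_mult powr_powr)
  then have "(\<integral>\<^sup>+x. ennreal (norm (pot s x powr m)) \<partial>lborel)
      \<le> (\<integral>\<^sup>+x. ennreal ?C * ennreal (bracket ((x::'a) /\<^sub>R \<epsilon>) powr (-(2 * \<alpha> * m))) \<partial>lborel)"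
    by (intro nn_integral_mono) (auto simp: ennreal_mult'[symmetric] intro!: ennreal_leI)
  also have "\<dots> = ennreal ?C * (ennreal (\<epsilon> ^ DIM('a)) *
      (\<integral>\<^sup>+y. ennreal (bracket (y::'a) powr (-(2 * \<alpha> * m))) \<partial>lborel))"
    using nn_integral_rescale[of "\<lambda>y::'a. ennreal (bracket y powr (-(2 * \<alpha> * m)))" \<epsilon> 0] \<epsilon>_pos
    by (simp add: nn_integral_cmult)
  also have "\<dots> < \<infinity>"
    using nn_integral_bracket_powr_finite[OF assms(3)]
    by (simp add: less_top[symmetric] ennreal_mult_eq_top_iff)
  finally show "(\<integral>\<^sup>+x. ennreal (norm (pot s x powr m)) \<partial>lborel) < \<infinity>" .
qed simp

text \<open>Only the mass starting in the ball of radius \<open>R\<close> is kept. Its endpoints lie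
  within \<open>R\<^sub>1\<close>, so these segments stay within \<open>R + R\<^sub>1\<close> of the
  origin.\<close>

lemma pot_ge:
  assumes "1 / 2 \<le> prob {z \<in> space \<gamma>. norm (fst z) \<le> R}" "0 < R" "s \<in> {0..1}"
  shows "1 / 2 * (bracket (x /\<^sub>R \<epsilon>) + (R + R\<^sub>1) / \<epsilon>) powr (-2 * \<alpha>) \<le> pot s x"
proof -
  let ?E = "{z \<in> space \<gamma>. norm (fst z) \<le> R}"
  let ?b = "(bracket (x /\<^sub>R \<epsilon>) + (R + R\<^sub>1) / \<epsilon>) powr (-2 * \<alpha>)"
  have "?b * prob ?E \<le> pot s x"
    unfolding pot_def
  proof (rule integral_ge_of_event[OF integrable_kernel])
    show "AE z in \<gamma>. z \<in> ?E \<longrightarrow> ?b \<le> bracket ((x - segm s z) /\<^sub>R \<epsilon>) powr (-2 * \<alpha>)"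
      using AE_snd
    proof eventually_elim
      case (elim z)
      show ?case
      proof
        assume "z \<in> ?E"
        then have "norm (segm s z) \<le> R + R\<^sub>1"
          using elim assms(3) by (intro norm_segm_le) auto
        then have "norm (segm s z) / \<epsilon> \<le> (R + R\<^sub>1) / \<epsilon>"
          using \<epsilon>_pos by (simp add: divide_right_mono)
        then have "bracket ((x - segm s z) /\<^sub>R \<epsilon>) \<le> bracket (x /\<^sub>R \<epsilon>) + (R + R\<^sub>1) / \<epsilon>"
          \<comment> \<open>The Lipschitz bound in the reverse direction, from x back to the shifted
            point.\<close>
          using bracket_rescale_le[of "x - segm s z" "- segm s z"] by simp
        then show "?b \<le> bracket ((x - segm s z) /\<^sub>R \<epsilon>) powr (-2 * \<alpha>)"
          using \<alpha>_pos by (intro powr_mono2') auto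
      qed
    qed
  qed auto
  moreover have "?b * (1 / 2) \<le> ?b * prob ?E"
    using assms(1) by (intro mult_left_mono) auto
  ultimately show ?thesis by simp
qed

text \<open>The negative exponent m - 1 reverses \<open>pot_ge\<close>, and the choice of \<alpha>
  turns the power of the bracket into exponent 1.\<close>

lemma pot_powr_le:
  assumes E: "1 / 2 \<le> prob {z \<in> space \<gamma>. norm (fst z) \<le> R}" and "0 < R" "s \<in> {0..1}"
    and m: "m < 1" "2 * \<alpha> * (1 - m) = 1"
  shows "pot s x powr (m - 1) \<le> 2 powr (1 - m) * (bracket (x /\<^sub>R \<epsilon>) + (R + R\<^sub>1) / \<epsilon>)"
proof -
  let ?B = "bracket (x /\<^sub>R \<epsilon>) + (R + R\<^sub>1) / \<epsilon>"
  have B: "0 < ?B"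
    using \<open>0 < R\<close> radii_nonneg \<epsilon>_pos by (intro add_pos_nonneg) auto
  have "pot s x powr (m - 1) \<le> (1 / 2 * ?B powr (-2 * \<alpha>)) powr (m - 1)"
    using pot_ge[OF E assms(2,3)] B m by (intro powr_mono2') auto
  also have "\<dots> = (1 / 2) powr (m - 1) * ?B powr (2 * \<alpha> * (1 - m))"
    by (simp only: powr_mult powr_powr) (simp add: algebra_simps)
  also have "(1 / 2) powr (m - 1) = (2::real) powr (1 - m)"
    by (simp add: powr_divide powr_minus[symmetric] powr_diff)
  also have "?B powr (2 * \<alpha> * (1 - m)) = ?B"
    using B m by simp
  finally show ?thesis .
qed

section \<open>The defect of the powered convolution, pointwise and integrated\<close>

text \<open>In \<kappa> the slope of the tangent contributes the factors up to the first
  1/\<epsilon>, the Green function b (1 - b), and the second derivative of the rescaled kernel the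
  rest. Together they carry the power \<epsilon>^(-3).\<close>

lemma pot_defect_le:
  assumes E: "1 / 2 \<le> prob {z \<in> space \<gamma>. norm (fst z) \<le> R}" and "0 < R" and b: "b \<in> {0..1}"
    and m: "0 < m" "m < 1" "2 * \<alpha> * (1 - m) = 1" and "\<epsilon> \<le> 1"
  defines "\<kappa> \<equiv> m * 2 powr (1 - m) * ((2 + R) * (1 + R\<^sub>0 + R\<^sub>1) / \<epsilon>) *
      (b * (1 - b) * (4 * \<alpha> * (\<alpha> + 1) / \<epsilon>\<^sup>2))"
  shows "ennreal ((1 - b) * pot 0 x powr m + b * pot 1 x powr m)
    \<le> ennreal (pot b x powr m) + (\<integral>\<^sup>+z. (\<integral>\<^sup>+s. ennreal (\<kappa> * (norm (snd z - fst z))\<^sup>2 *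
        bracket ((x - segm s z) /\<^sub>R \<epsilon>) powr (-(2 * \<alpha> + 1))) * indicator {0..1} s \<partial>lborel) \<partial>\<gamma>)"
proof -
  define k where "k s z = bracket ((x - segm s z) /\<^sub>R \<epsilon>) powr (-2 * \<alpha>)" for s z
  define w where "w = m * pot b x powr (m - 1)"
  have w: "0 \<le> w"
    using m by (simp add: w_def)
  have k_int: "integrable \<gamma> (k s)" for s
    unfolding k_def by (rule integrable_kernel)
  have pot_k: "pot s x = (LINT z|\<gamma>. k s z)" for s
    by (simp add: pot_def k_def)
  \<comment> \<open>The tangent is taken at \<open>pot b x\<close>, which must be strictly
    positive.\<close>
  have "0 < bracket (x /\<^sub>R \<epsilon>) + (R + R\<^sub>1) / \<epsilon>"
    using \<open>0 < R\<close> radii_nonneg \<epsilon>_pos by (intro add_pos_nonneg) auto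
  then have "0 < (bracket (x /\<^sub>R \<epsilon>) + (R + R\<^sub>1) / \<epsilon>) powr (-2 * \<alpha>)"
    by simp
  then have pot_pos: "0 < pot b x"
    using pot_ge[OF E \<open>0 < R\<close> b, of x] by linarith
  have tan: "pot s x powr m \<le> pot b x powr m + w * (pot s x - pot b x)" for s
    unfolding w_def using m pot_pos pot_nonneg by (intro powr_tangent_le) auto
  have "(1 - b) * pot 0 x powr m + b * pot 1 x powr m
      \<le> (1 - b) * (pot b x powr m + w * (pot 0 x - pot b x))
        + b * (pot b x powr m + w * (pot 1 x - pot b x))"
    using b by (intro add_mono mult_left_mono tan) auto
  also have "\<dots> = pot b x powr m + w * ((1 - b) * pot 0 x + b * pot 1 x - pot b x)"
    by (simp add: algebra_simps)
  also have "\<dots> = pot b x powr m + (LINT z|\<gamma>. w * ((1 - b) * k 0 z + b * k 1 z - k b z))"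
    using k_int by (simp add: pot_k)
  finally have "ennreal ((1 - b) * pot 0 x powr m + b * pot 1 x powr m)
      \<le> ennreal (pot b x powr m) + ennreal (LINT z|\<gamma>. w * ((1 - b) * k 0 z + b * k 1 z - k b z))"
    \<comment> \<open>The averaged defect may be negative, so the sum splits only as an
      inequality.\<close>
    by (rule order_trans[OF ennreal_leI ennreal_add_le]) simp
  also have "ennreal (LINT z|\<gamma>. w * ((1 - b) * k 0 z + b * k 1 z - k b z))
      \<le> (\<integral>\<^sup>+z. ennreal (w * ((1 - b) * k 0 z + b * k 1 z - k b z)) \<partial>\<gamma>)"
    by (rule ennreal_integral_le_nn_integral)
  also have "\<dots> \<le> (\<integral>\<^sup>+z. (\<integral>\<^sup>+s. ennreal (\<kappa> * (norm (snd z - fst z))\<^sup>2 *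
        bracket ((x - segm s z) /\<^sub>R \<epsilon>) powr (-(2 * \<alpha> + 1))) * indicator {0..1} s \<partial>lborel) \<partial>\<gamma>)"
  proof (rule nn_integral_mono_AE)
    show "AE z in \<gamma>. ennreal (w * ((1 - b) * k 0 z + b * k 1 z - k b z))
      \<le> (\<integral>\<^sup>+s. ennreal (\<kappa> * (norm (snd z - fst z))\<^sup>2 *
        bracket ((x - segm s z) /\<^sub>R \<epsilon>) powr (-(2 * \<alpha> + 1))) * indicator {0..1} s \<partial>lborel)"
      using AE_norm_segm
    proof eventually_elim
      case (elim z)
      \<comment> \<open>In rescaled coordinates the shifted point moves along u - s h; the square of
        the norm of \<open>h\<close> supplies \<epsilon>^(-2).\<close>
      define h where "h = (snd z - fst z) /\<^sub>R \<epsilon>"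
      define u where "u = (x - fst z) /\<^sub>R \<epsilon>"
      let ?c = "b * (1 - b) * (4 * \<alpha> * (\<alpha> + 1) * (norm h)\<^sup>2)"
      have u_h: "(x - segm s z) /\<^sub>R \<epsilon> = u - s *\<^sub>R h" for s
        unfolding u_def h_def segm_def
        by (simp add: scaleR_diff_right scaleR_diff_left scaleR_add_right mult.commute algebra_simps)
      have "ennreal ((1 - b) * k 0 z + b * k 1 z - k b z)
          \<le> (\<integral>\<^sup>+s. ennreal (b * (1 - b) * (4 * \<alpha> * (\<alpha> + 1) * (norm h)\<^sup>2 *
              bracket (u - s *\<^sub>R h) powr (-2 * \<alpha> - 2))) * indicator {0..1} s \<partial>lborel)"
        using bracket_powr_defect_le[of \<alpha> b u h] \<alpha>_pos b by (simp add: k_def u_h)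
      then have "ennreal w * ennreal ((1 - b) * k 0 z + b * k 1 z - k b z)
          \<le> ennreal w * (\<integral>\<^sup>+s. ennreal (b * (1 - b) * (4 * \<alpha> * (\<alpha> + 1) * (norm h)\<^sup>2 *
              bracket (u - s *\<^sub>R h) powr (-2 * \<alpha> - 2))) * indicator {0..1} s \<partial>lborel)"
        by (rule mult_left_mono) simp
      also have "\<dots> = (\<integral>\<^sup>+s. ennreal (w * (?c * bracket (u - s *\<^sub>R h) powr (-2 * \<alpha> - 2)))
            * indicator {0..1} s \<partial>lborel)"
        using w by (subst nn_integral_cmult[symmetric]) (auto simp: ennreal_mult' mult.assoc)
      also have "\<dots> \<le> (\<integral>\<^sup>+s. ennreal (\<kappa> * (norm (snd z - fst z))\<^sup>2 *
        bracket ((x - segm s z) /\<^sub>R \<epsilon>) powr (-(2 * \<alpha> + 1))) * indicator {0..1} s \<partial>lborel)"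
      proof (rule nn_integral_mono)
        fix s :: real
        show "ennreal (w * (?c * bracket (u - s *\<^sub>R h) powr (-2 * \<alpha> - 2))) * indicator {0..1} s
          \<le> ennreal (\<kappa> * (norm (snd z - fst z))\<^sup>2 *
              bracket ((x - segm s z) /\<^sub>R \<epsilon>) powr (-(2 * \<alpha> + 1))) * indicator {0..1} s"
        proof (cases "s \<in> {0..1}")
          case True
          let ?y = "u - s *\<^sub>R h" and ?M = "(2 + R) * (1 + R\<^sub>0 + R\<^sub>1) / \<epsilon>"
          have "bracket (x /\<^sub>R \<epsilon>) \<le> bracket ?y + norm (segm s z) / \<epsilon>"
            using bracket_rescale_le[of x "segm s z"] by (simp add: u_h)
          also have "norm (segm s z) / \<epsilon> \<le> (R\<^sub>0 + R\<^sub>1) / \<epsilon>"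
            using elim True \<epsilon>_pos by (simp add: divide_right_mono)
          finally have "bracket (x /\<^sub>R \<epsilon>) + (R + R\<^sub>1) / \<epsilon>
              \<le> bracket ?y * 1 + 1 * ((R\<^sub>0 + R\<^sub>1) / \<epsilon> + (R + R\<^sub>1) / \<epsilon>)"
            by simp
          \<comment> \<open>Both 1 \<le> 1/\<epsilon> and 1 \<le> \<open>bracket ?y\<close> are used
            to pull out the common factor \<open>bracket ?y\<close> / \<epsilon>.\<close>
          also have "\<dots> \<le> bracket ?y * (1 / \<epsilon>) + bracket ?y * ((R\<^sub>0 + R\<^sub>1) / \<epsilon> + (R + R\<^sub>1) / \<epsilon>)"
            using bracket_ge_1[of ?y] radii_nonneg \<open>0 < R\<close> \<epsilon>_pos \<open>\<epsilon> \<le> 1\<close>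
            by (intro add_mono mult_left_mono mult_right_mono) auto
          also have "\<dots> = bracket ?y * ((1 + (R\<^sub>0 + R\<^sub>1) + (R + R\<^sub>1)) / \<epsilon>)"
            by (simp add: add_divide_distrib distrib_left)
          also have "\<dots> \<le> bracket ?y * ?M"
          proof -
            have "1 + (R\<^sub>0 + R\<^sub>1) + (R + R\<^sub>1) \<le> (2 + R) * (1 + R\<^sub>0 + R\<^sub>1)"
              using radii_nonneg \<open>0 < R\<close> mult_nonneg_nonneg[of R "R\<^sub>0 + R\<^sub>1"]
              by (simp add: algebra_simps)
            then show ?thesis
              using \<epsilon>_pos by (intro mult_left_mono divide_right_mono) (auto intro: less_imp_le)
          qed
          finally have "pot b x powr (m - 1) \<le> 2 powr (1 - m) * (bracket ?y * ?M)"
            using pot_powr_le[OF E \<open>0 < R\<close> b m(2,3), of x]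
            by (meson mult_left_mono order_trans powr_ge_zero)
          then have "w \<le> m * (2 powr (1 - m) * (bracket ?y * ?M))"
            unfolding w_def using m by (intro mult_left_mono) auto
          then have "w * (?c * bracket ?y powr (-2 * \<alpha> - 2))
              \<le> m * (2 powr (1 - m) * (bracket ?y * ?M)) * (?c * bracket ?y powr (-2 * \<alpha> - 2))"
            using b \<alpha>_pos by (intro mult_right_mono) auto
          also have "\<dots> = m * 2 powr (1 - m) * ?M * ?c
              * (bracket ?y powr 1 * bracket ?y powr (-2 * \<alpha> - 2))"
            by (simp add: abs_of_pos)
          also have "bracket ?y powr 1 * bracket ?y powr (-2 * \<alpha> - 2) = bracket ?y powr (-(2 * \<alpha> + 1))"
            by (subst powr_add[symmetric]) (rule arg_cong, simp)
          also have "m * 2 powr (1 - m) * ?M * ?c = \<kappa> * (norm (snd z - fst z))\<^sup>2"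
            unfolding \<kappa>_def h_def using \<epsilon>_pos
            by (simp add: power_mult_distrib power_inverse divide_inverse)
          finally show ?thesis
            using True by (simp add: u_h ennreal_leI)
        qed simp
      qed
      finally show ?case
        using w by (simp add: ennreal_mult')
    qed
  qed
  finally show ?thesis
    by (simp add: add_left_mono)
qed

text \<open>Tonelli moves the integral over x innermost, past the plan and then past time. There it
  is translation invariant, time contributes the length of the unit interval, and the squared
  displacement integrates to the cost.\<close>

lemma integral_pot_defect_le:
  assumes E: "1 / 2 \<le> prob {z \<in> space \<gamma>. norm (fst z) \<le> R}" and "0 < R" and b: "b \<in> {0..1}"
    and m: "0 < m" "m < 1" "2 * \<alpha> * (1 - m) = 1" and "\<epsilon> \<le> 1"
    and dim: "real DIM('a) < 2 * \<alpha> * m"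
  defines "\<kappa> \<equiv> m * 2 powr (1 - m) * ((2 + R) * (1 + R\<^sub>0 + R\<^sub>1) / \<epsilon>) *
      (b * (1 - b) * (4 * \<alpha> * (\<alpha> + 1) / \<epsilon>\<^sup>2))"
  shows "ennreal ((1 - b) * (LINT x|lborel. pot 0 x powr m) + b * (LINT x|lborel. pot 1 x powr m))
    \<le> ennreal (LINT x|lborel. pot b x powr m) + ennreal \<kappa> * (ennreal (\<epsilon> ^ DIM('a)) *
        (\<integral>\<^sup>+y. ennreal (bracket (y::'a) powr (-(2 * \<alpha> + 1))) \<partial>lborel)) * transport_cost \<gamma>"
proof -
  let ?F = "\<lambda>x z s. ennreal (\<kappa> * (norm (snd z - fst z))\<^sup>2 *
        bracket ((x - segm s z) /\<^sub>R \<epsilon>) powr (-(2 * \<alpha> + 1))) * indicator {0..1} s"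
  let ?I = "\<integral>\<^sup>+y. ennreal (bracket (y::'a) powr (-(2 * \<alpha> + 1))) \<partial>lborel"
  interpret N: pair_sigma_finite \<gamma> "lborel :: 'a measure" ..
  have \<kappa>: "0 \<le> \<kappa>"
    unfolding \<kappa>_def using m b \<alpha>_pos \<epsilon>_pos \<open>0 < R\<close> radii_nonneg by auto
  have int: "integrable lborel (\<lambda>x. pot s x powr m)" if "s \<in> {0..1}" for s
    using that m(1) dim by (rule integrable_pot_powr)
  have "ennreal ((1 - b) * (LINT x|lborel. pot 0 x powr m) + b * (LINT x|lborel. pot 1 x powr m))
      = ennreal (LINT x|lborel. (1 - b) * pot 0 x powr m + b * pot 1 x powr m)"
    using int[of 0] int[of 1] by simp
  also have "\<dots> = (\<integral>\<^sup>+x. ennreal ((1 - b) * pot 0 x powr m + b * pot 1 x powr m) \<partial>lborel)"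
    using int[of 0] int[of 1] b by (intro nn_integral_eq_integral[symmetric]) auto
  also have "\<dots> \<le> (\<integral>\<^sup>+x. ennreal (pot b x powr m) + (\<integral>\<^sup>+z. (\<integral>\<^sup>+s. ?F x z s \<partial>lborel) \<partial>\<gamma>) \<partial>lborel)"
    using pot_defect_le[OF E \<open>0 < R\<close> b m \<open>\<epsilon> \<le> 1\<close>] unfolding \<kappa>_def[symmetric]
    by (intro nn_integral_mono)
  also have "\<dots> = (\<integral>\<^sup>+x. ennreal (pot b x powr m) \<partial>lborel)
      + (\<integral>\<^sup>+x. (\<integral>\<^sup>+z. (\<integral>\<^sup>+s. ?F x z s \<partial>lborel) \<partial>\<gamma>) \<partial>lborel)"
    by (rule nn_integral_add) measurable
  also have "(\<integral>\<^sup>+x. ennreal (pot b x powr m) \<partial>lborel) = ennreal (LINT x|lborel. pot b x powr m)"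
    using int[OF b] by (intro nn_integral_eq_integral) auto
  also have "(\<integral>\<^sup>+x. (\<integral>\<^sup>+z. (\<integral>\<^sup>+s. ?F x z s \<partial>lborel) \<partial>\<gamma>) \<partial>lborel)
      = (\<integral>\<^sup>+z. (\<integral>\<^sup>+x. (\<integral>\<^sup>+s. ?F x z s \<partial>lborel) \<partial>lborel) \<partial>\<gamma>)"
    by (rule N.Fubini') measurable
  also have "\<dots> = (\<integral>\<^sup>+z. (\<integral>\<^sup>+s. (\<integral>\<^sup>+x. ?F x z s \<partial>lborel) \<partial>lborel) \<partial>\<gamma>)"
  proof (rule nn_integral_cong)
    fix z :: "'a \<times> 'a"
    have [measurable]: "z \<in> space (borel \<Otimes>\<^sub>M borel)"
      by (simp add: space_pair_measure)
    show "(\<integral>\<^sup>+x. (\<integral>\<^sup>+s. ?F x z s \<partial>lborel) \<partial>lborel) = (\<integral>\<^sup>+s. (\<integral>\<^sup>+x. ?F x z s \<partial>lborel) \<partial>lborel)"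
      by (rule lborel_pair.Fubini') measurable
  qed
  also have "\<dots> = (\<integral>\<^sup>+z. ennreal (\<kappa> * (norm (snd z - fst z))\<^sup>2) * (ennreal (\<epsilon> ^ DIM('a)) * ?I) \<partial>\<gamma>)"
  proof (rule nn_integral_cong)
    fix z :: "'a \<times> 'a"
    let ?k = "ennreal (\<kappa> * (norm (snd z - fst z))\<^sup>2)"
    have "(\<integral>\<^sup>+x. ?F x z s \<partial>lborel) = ?k * (ennreal (\<epsilon> ^ DIM('a)) * ?I) * indicator {0..1} s" for s
    proof -
      have "(\<integral>\<^sup>+x. ?F x z s \<partial>lborel) = (\<integral>\<^sup>+x. ?k * indicator {0..1} s *
          ennreal (bracket ((x - segm s z) /\<^sub>R \<epsilon>) powr (-(2 * \<alpha> + 1))) \<partial>lborel)"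
        using \<kappa> by (intro nn_integral_cong) (simp add: ennreal_mult' mult_ac)
      also have "\<dots> = ?k * indicator {0..1} s *
          (\<integral>\<^sup>+x. ennreal (bracket ((x - segm s z) /\<^sub>R \<epsilon>) powr (-(2 * \<alpha> + 1))) \<partial>lborel)"
        by (rule nn_integral_cmult) measurable
      also have "(\<integral>\<^sup>+x. ennreal (bracket ((x - segm s z) /\<^sub>R \<epsilon>) powr (-(2 * \<alpha> + 1))) \<partial>lborel)
          = ennreal (\<epsilon> ^ DIM('a)) * ?I"
        using \<epsilon>_pos by (intro nn_integral_rescale) auto
      finally show ?thesis by (simp add: mult_ac)
    qed
    then show "(\<integral>\<^sup>+s. (\<integral>\<^sup>+x. ?F x z s \<partial>lborel) \<partial>lborel) = ?k * (ennreal (\<epsilon> ^ DIM('a)) * ?I)"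
      by (simp add: nn_integral_cmult_indicator)
  qed
  also have "\<dots> = (\<integral>\<^sup>+z. ennreal \<kappa> * (ennreal (\<epsilon> ^ DIM('a)) * ?I) *
      ennreal ((dist (fst z) (snd z))\<^sup>2) \<partial>\<gamma>)"
    using \<kappa> by (intro nn_integral_cong) (simp add: ennreal_mult' dist_norm norm_minus_commute mult_ac)
  also have "\<dots> = ennreal \<kappa> * (ennreal (\<epsilon> ^ DIM('a)) * ?I) * transport_cost \<gamma>"
    unfolding transport_cost_def by (rule nn_integral_cmult) measurable
  finally show ?thesis .
qed

end

section \<open>Exponents, normalisation and the final estimate\<close>

text \<open>As 2 \<alpha> = 1/(1 - m), this is the condition d < 2 \<alpha> m for integrability of
  the powered convolution. If it failed, multiplying by \<open>m\<close> would bound the quadratic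
  by -(1 - m)(2 - m).\<close>

lemma dim_less_of_quadratic:
  fixes d m :: real
  assumes "0 < m" "m < 1" "d * m\<^sup>2 + (3 - d) * m - 2 > 0"
  shows "d < m / (1 - m)"
proof (rule ccontr)
  assume "\<not> d < m / (1 - m)"
  then have "m \<le> d * (1 - m)"
    using assms by (simp add: field_simps)
  then have "m * m \<le> m * (d * (1 - m))"
    using assms by (intro mult_left_mono) auto
  then have "d * m\<^sup>2 + (3 - d) * m - 2 \<le> - ((1 - m) * (2 - m))"
    by (simp add: power2_eq_square algebra_simps)
  also have "\<dots> \<le> 0"
    using assms by simp
  finally show False using assms by simp
qed

text \<open>This holds irrespective of integrability: the default integral 0 gives 1 / 0 =
  0.\<close>

lemma kernel_const_nonneg: "0 \<le> kernel_const T \<alpha>"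
  unfolding kernel_const_def by (intro divide_nonneg_nonneg integral_nonneg_AE) auto

lemma interpolation_eq_distr_segm: "interpolation \<gamma> s = distr \<gamma> borel (segm s)"
  by (simp add: interpolation_def segm_def[abs_def])

context bounded_plan
begin

text \<open>Change of variables turns the convolution with the pushforward into an integral over the
  plan.\<close>

lemma reg_energy_interpolation:
  "reg_energy (bracket_kernel \<alpha>) m \<epsilon> (interpolation \<gamma> s)
    = - (1 / (1 - m)) * ((kernel_const TYPE('a) \<alpha> / \<epsilon> ^ DIM('a)) powr m
        * (LINT x|lborel. pot s x powr m))"
proof -
  let ?A = "kernel_const TYPE('a) \<alpha> / \<epsilon> ^ DIM('a)"
  have A: "0 \<le> ?A"
    using kernel_const_nonneg[of "TYPE('a)" \<alpha>] \<epsilon>_pos by simp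
  have "conv_measure (rescale \<epsilon> (bracket_kernel \<alpha>)) (interpolation \<gamma> s) x = ?A * pot s x" for x
  proof -
    have "conv_measure (rescale \<epsilon> (bracket_kernel \<alpha>)) (interpolation \<gamma> s) x
        = (LINT z|\<gamma>. rescale \<epsilon> (bracket_kernel \<alpha>) (x - segm s z))"
      unfolding conv_measure_def interpolation_eq_distr_segm
      by (rule integral_distr) (auto simp: rescale_def bracket_kernel_def)
    also have "\<dots> = (LINT z|\<gamma>. ?A * bracket ((x - segm s z) /\<^sub>R \<epsilon>) powr (-2 * \<alpha>))"
      by (simp add: rescale_def bracket_kernel_def)
    finally show ?thesis by (simp add: pot_def)
  qed
  then show ?thesis
    by (simp only: reg_energy_def abs_mult abs_of_nonneg[OF A] abs_of_nonneg[OF pot_nonneg]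
        powr_mult integral_mult_right_zero)
qed

end

theorem proposition6p5:
  fixes m \<alpha> R :: real and V :: "'a::euclidean_space \<Rightarrow> real"
  assumes "real DIM('a) / (real DIM('a) + 2) < m" and "m < 1"
    and "real DIM('a) * m\<^sup>2 + (3 - real DIM('a)) * m - 2 > 0"
    and "\<alpha> = 1 / (2 * (1 - m))"
    and "V = bracket_kernel \<alpha>"
    and "R > 0"
  shows "\<exists>C>0. \<forall>\<^sub>F \<epsilon> in at_right (0::real).
    \<forall>(\<rho>\<^sub>0 :: 'a measure) (\<rho>\<^sub>1 :: 'a measure) R\<^sub>0 R\<^sub>1 \<gamma>.
      \<rho>\<^sub>0 \<in> P2 \<longrightarrow> \<rho>\<^sub>1 \<in> P2 \<longrightarrow> R\<^sub>0 > 0 \<longrightarrow> R\<^sub>1 > 0 \<longrightarrow>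
      measure_support \<rho>\<^sub>0 = cball 0 R\<^sub>0 \<longrightarrow> measure_support \<rho>\<^sub>1 = cball 0 R\<^sub>1 \<longrightarrow>
      measure \<rho>\<^sub>0 (cball 0 R) \<ge> 1 / 2 \<longrightarrow>
      optimal_plan \<rho>\<^sub>0 \<rho>\<^sub>1 \<gamma> \<longrightarrow>
      lambda_convex_along (- (C * (1 + R\<^sub>0 + R\<^sub>1)) / \<epsilon> ^ 3) (reg_energy V m \<epsilon>) (interpolation \<gamma>)"
proof -
  let ?d = "DIM('a)"
  define c where "c = kernel_const TYPE('a) \<alpha>"
  define W where "W = enn2real (\<integral>\<^sup>+y. ennreal (bracket (y::'a) powr (-(2 * \<alpha> + 1))) \<partial>lborel)"
  \<comment> \<open>\<open>B\<close> collects the factors of the error that depend neither on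
    \<epsilon>, nor on the two support radii, nor on time.\<close>
  define B where "B = 1 / (1 - m) * (c powr m * (m * 2 powr (1 - m) * (2 + R) * (4 * \<alpha> * (\<alpha> + 1)) * W))"
  have m: "0 < m"
    using assms(1) by (rule le_less_trans[rotated]) simp
  have \<alpha>: "0 < \<alpha>" "2 * \<alpha> * (1 - m) = 1"
    using assms(2,4) by simp_all
  have "2 * \<alpha> = 1 / (1 - m)"
    using \<alpha>(2) assms(2) by (simp add: eq_divide_eq)
  then have dim: "real ?d < 2 * \<alpha> * m"
    using dim_less_of_quadratic[OF m assms(2,3)] by (metis mult_1_left times_divide_eq_left)
  also have "\<dots> < 2 * \<alpha> + 1"
  proof -
    have "2 * \<alpha> * m \<le> 2 * \<alpha> * 1"
      using \<alpha>(1) assms(2) by (intro mult_left_mono) auto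
    then show ?thesis by simp
  qed
  finally have "(\<integral>\<^sup>+y. ennreal (bracket (y::'a) powr (-(2 * \<alpha> + 1))) \<partial>lborel) < \<infinity>"
    by (rule nn_integral_bracket_powr_finite)
  then have W: "(\<integral>\<^sup>+y. ennreal (bracket (y::'a) powr (-(2 * \<alpha> + 1))) \<partial>lborel) = ennreal W" "0 \<le> W"
    by (simp_all add: W_def)
  have c: "0 \<le> c"
    unfolding c_def by (rule kernel_const_nonneg)
  have B: "0 \<le> B"
    unfolding B_def using assms(2,6) m \<alpha> W c by auto
  \<comment> \<open>In 2 B + 1 the factor 2 undoes the halving of \<open>lam\<close>, and the 1
    secures positivity, as only 0 \<le> \<open>B\<close> has been shown.\<close>
  have conv: "lambda_convex_along (- ((2 * B + 1) * (1 + R\<^sub>0 + R\<^sub>1)) / \<epsilon> ^ 3)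
      (reg_energy V m \<epsilon>) (interpolation \<gamma>)"
    if \<epsilon>: "0 < \<epsilon>" "\<epsilon> \<le> 1" and R: "R\<^sub>0 > 0" "R\<^sub>1 > 0"
      and supp: "measure_support \<rho>\<^sub>0 = cball 0 R\<^sub>0" "measure_support \<rho>\<^sub>1 = cball 0 R\<^sub>1"
      and half: "1 / 2 \<le> measure \<rho>\<^sub>0 (cball 0 R)"
      and opt: "optimal_plan \<rho>\<^sub>0 \<rho>\<^sub>1 \<gamma>"
    for \<epsilon> R\<^sub>0 R\<^sub>1 :: real and \<rho>\<^sub>0 \<rho>\<^sub>1 :: "'a measure" and \<gamma>
  proof -
    have \<gamma>: "prob_space \<gamma>" "sets \<gamma> = sets (borel \<Otimes>\<^sub>M borel)"
      and fst: "distr \<gamma> borel fst = \<rho>\<^sub>0" and snd: "distr \<gamma> borel snd = \<rho>\<^sub>1"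
      using opt unfolding borel_prod by (auto simp: optimal_plan_def couplings_def)
    note [measurable_cong] = \<gamma>(2)
    have "AE x in distr \<gamma> borel fst. x \<in> cball 0 R\<^sub>0"
      using AE_in_measure_support[of \<rho>\<^sub>0] fst supp by auto
    then have fst_le: "AE z in \<gamma>. norm (fst z) \<le> R\<^sub>0"
      by (subst (asm) AE_distr_iff) auto
    have "AE x in distr \<gamma> borel snd. x \<in> cball 0 R\<^sub>1"
      using AE_in_measure_support[of \<rho>\<^sub>1] snd supp by auto
    then have snd_le: "AE z in \<gamma>. norm (snd z) \<le> R\<^sub>1"
      by (subst (asm) AE_distr_iff) auto
    interpret bounded_plan \<gamma> \<alpha> \<epsilon> R\<^sub>0 R\<^sub>1
      using \<gamma> fst_le snd_le \<alpha> \<epsilon> by (intro bounded_plan.intro bounded_plan_axioms.intro)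
    have "fst -` cball 0 R \<inter> space \<gamma> = {z \<in> space \<gamma>. norm (fst z) \<le> R}"
      by auto
    then have E: "1 / 2 \<le> prob {z \<in> space \<gamma>. norm (fst z) \<le> R}"
      using half unfolding fst[symmetric] by (subst (asm) measure_distr) auto
    have "transport_cost \<gamma> \<le> (\<integral>\<^sup>+z. ennreal ((R\<^sub>0 + R\<^sub>1)\<^sup>2) \<partial>\<gamma>)"
      unfolding transport_cost_def
    proof (rule nn_integral_mono_AE)
      show "AE z in \<gamma>. ennreal ((dist (fst z) (snd z))\<^sup>2) \<le> ennreal ((R\<^sub>0 + R\<^sub>1)\<^sup>2)"
        using fst_le snd_le
      proof eventually_elim
        case (elim z)
        then have "dist (fst z) (snd z) \<le> R\<^sub>0 + R\<^sub>1"
          using norm_triangle_ineq4[of "fst z" "snd z"] by (simp add: dist_norm)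
        then show ?case
          by (intro ennreal_leI power_mono) auto
      qed
    qed
    also have "\<dots> < \<infinity>"
      by (simp add: emeasure_space_1)
    finally have "transport_cost \<gamma> < \<infinity>" .
    \<comment> \<open>Optimality turns the cost produced by the estimate into the squared distance
      of the convexity inequality.\<close>
    then have cost: "transport_cost \<gamma> = ennreal ((wasserstein_dist \<rho>\<^sub>0 \<rho>\<^sub>1)\<^sup>2)"
      by (rule optimal_plan_cost[OF opt])
    have ends: "interpolation \<gamma> 0 = \<rho>\<^sub>0" "interpolation \<gamma> 1 = \<rho>\<^sub>1"
      using fst snd by (simp_all add: interpolation_def)
    define D where "D = (wasserstein_dist \<rho>\<^sub>0 \<rho>\<^sub>1)\<^sup>2"
    define J where "J s = (LINT x|lborel. pot s x powr m)" for s
    define A where "A = (c / \<epsilon> ^ ?d) powr m"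
    have D: "0 \<le> D" by (simp add: D_def)
    have J: "0 \<le> J s" for s
      unfolding J_def by (rule integral_nonneg_AE) simp
    show ?thesis
      unfolding lambda_convex_along_def ends
    proof
      fix b :: real
      assume b: "b \<in> {0..1}"
      define \<kappa> where "\<kappa> = m * 2 powr (1 - m) * ((2 + R) * (1 + R\<^sub>0 + R\<^sub>1) / \<epsilon>) *
        (b * (1 - b) * (4 * \<alpha> * (\<alpha> + 1) / \<epsilon>\<^sup>2))"
      have \<kappa>: "0 \<le> \<kappa>"
        unfolding \<kappa>_def using m b \<alpha> \<epsilon> \<open>R > 0\<close> R by auto
      have "ennreal ((1 - b) * J 0 + b * J 1)
          \<le> ennreal (J b) + ennreal \<kappa> * (ennreal (\<epsilon> ^ ?d) * ennreal W) * ennreal D"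
        using integral_pot_defect_le[OF E \<open>R > 0\<close> b m assms(2) \<alpha>(2) \<epsilon>(2) dim]
        unfolding J_def D_def W(1) cost \<kappa>_def .
      also have "\<dots> = ennreal (J b + \<kappa> * (\<epsilon> ^ ?d * W) * D)"
        using J \<kappa> \<epsilon> W D by (simp add: ennreal_mult'[symmetric] ennreal_plus[symmetric] del: ennreal_plus)
      finally have le: "(1 - b) * J 0 + b * J 1 \<le> J b + \<kappa> * (\<epsilon> ^ ?d * W) * D"
        using J \<kappa> \<epsilon> W D by (subst (asm) ennreal_le_iff) auto
      \<comment> \<open>The normalisation \<epsilon>^(-d m) of the kernel meets the Jacobian
        \<epsilon>^d, leaving \<epsilon>^(d (1 - m)) \<le> 1.\<close>
      have "A * \<epsilon> ^ ?d \<le> c powr m"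
      proof -
        have "(\<epsilon> ^ ?d) powr (1 - m) = \<epsilon> ^ ?d / (\<epsilon> ^ ?d) powr m"
          using \<epsilon> by (simp add: powr_diff)
        then have "A * \<epsilon> ^ ?d = c powr m * (\<epsilon> ^ ?d) powr (1 - m)"
          unfolding A_def using c \<epsilon> by (simp add: powr_divide)
        also have "\<dots> \<le> c powr m * 1"
          using \<epsilon> assms(2) by (intro mult_left_mono powr_le1) (auto intro: power_le_one)
        finally show ?thesis by simp
      qed
      then have "1 / (1 - m) * (A * \<epsilon> ^ ?d) * (\<kappa> * W * D) \<le> 1 / (1 - m) * c powr m * (\<kappa> * W * D)"
        using \<kappa> W D assms(2) by (intro mult_right_mono mult_left_mono) auto
      also have "\<dots> = B * (1 + R\<^sub>0 + R\<^sub>1) / \<epsilon> ^ 3 * b * (1 - b) * D"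
        unfolding B_def \<kappa>_def using \<epsilon>
          by (simp add: power2_eq_square power3_eq_cube mult_ac)
      also have "\<dots> \<le> (B + 1 / 2) * (1 + R\<^sub>0 + R\<^sub>1) / \<epsilon> ^ 3 * b * (1 - b) * D"
        using R \<epsilon> b D by (intro mult_right_mono divide_right_mono) auto
      finally have err: "1 / (1 - m) * (A * \<epsilon> ^ ?d) * (\<kappa> * W * D)
          \<le> (B + 1 / 2) * (1 + R\<^sub>0 + R\<^sub>1) / \<epsilon> ^ 3 * b * (1 - b) * D" .
      have "1 / (1 - m) * A * ((1 - b) * J 0 + b * J 1)
          \<le> 1 / (1 - m) * A * (J b + \<kappa> * (\<epsilon> ^ ?d * W) * D)"
        using le assms(2) by (intro mult_left_mono) (auto simp: A_def)
      also have "\<dots> = 1 / (1 - m) * A * J b + 1 / (1 - m) * (A * \<epsilon> ^ ?d) * (\<kappa> * W * D)"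
        by (simp only: distrib_left mult_ac)
      finally have fin: "1 / (1 - m) * A * ((1 - b) * J 0 + b * J 1)
          \<le> 1 / (1 - m) * A * J b + (B + 1 / 2) * (1 + R\<^sub>0 + R\<^sub>1) / \<epsilon> ^ 3 * b * (1 - b) * D"
        using err by linarith
      have en: "reg_energy V m \<epsilon> (interpolation \<gamma> s) = - (1 / (1 - m) * A * J s)" for s
        unfolding assms(5) reg_energy_interpolation A_def J_def c_def by simp
      show "reg_energy V m \<epsilon> (interpolation \<gamma> b)
          \<le> (1 - b) * reg_energy V m \<epsilon> \<rho>\<^sub>0 + b * reg_energy V m \<epsilon> \<rho>\<^sub>1
            - - ((2 * B + 1) * (1 + R\<^sub>0 + R\<^sub>1)) / \<epsilon> ^ 3 / 2 * b * (1 - b)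
              * (wasserstein_dist \<rho>\<^sub>0 \<rho>\<^sub>1)\<^sup>2"
      proof -
        have "- ((2 * B + 1) * (1 + R\<^sub>0 + R\<^sub>1)) / \<epsilon> ^ 3 / 2 = - ((B + 1 / 2) * (1 + R\<^sub>0 + R\<^sub>1) / \<epsilon> ^ 3)"
          using \<epsilon> by (simp add: field_simps)
        moreover define k L where "k = 1 / (1 - m) * A"
          and "L = (B + 1 / 2) * (1 + R\<^sub>0 + R\<^sub>1) / \<epsilon> ^ 3"
        moreover have "- (k * J b) \<le> (1 - b) * - (k * J 0) + b * - (k * J 1) - - L * b * (1 - b) * D"
          using fin unfolding k_def[symmetric] L_def[symmetric] by (simp add: algebra_simps)
        ultimately show ?thesis
          unfolding ends[symmetric] en unfolding ends D_def[symmetric] by simp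
      qed
    qed
  qed
  \<comment> \<open>The threshold 1 for \<epsilon> is independent of the measures and of their
    radii.\<close>
  have "\<forall>\<^sub>F \<epsilon> in at_right (0::real). 0 < \<epsilon> \<and> \<epsilon> \<le> 1"
    unfolding eventually_at_right_field by (intro exI[of _ 1]) auto
  then have "\<forall>\<^sub>F \<epsilon> in at_right (0::real).
    \<forall>(\<rho>\<^sub>0 :: 'a measure) (\<rho>\<^sub>1 :: 'a measure) R\<^sub>0 R\<^sub>1 \<gamma>.
      \<rho>\<^sub>0 \<in> P2 \<longrightarrow> \<rho>\<^sub>1 \<in> P2 \<longrightarrow> R\<^sub>0 > 0 \<longrightarrow> R\<^sub>1 > 0 \<longrightarrow>
      measure_support \<rho>\<^sub>0 = cball 0 R\<^sub>0 \<longrightarrow> measure_support \<rho>\<^sub>1 = cball 0 R\<^sub>1 \<longrightarrow>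
      measure \<rho>\<^sub>0 (cball 0 R) \<ge> 1 / 2 \<longrightarrow>
      optimal_plan \<rho>\<^sub>0 \<rho>\<^sub>1 \<gamma> \<longrightarrow>
      lambda_convex_along (- ((2 * B + 1) * (1 + R\<^sub>0 + R\<^sub>1)) / \<epsilon> ^ 3)
        (reg_energy V m \<epsilon>) (interpolation \<gamma>)"
    by eventually_elim (use conv in blast)
  then show ?thesis
    using B by (intro exI[of _ "2 * B + 1"]) simp
qed

end
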